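(* Let $\mathbb K$ be a field of characteristic $0$ and let $(\mathfrak m,[\,,],\alpha)$ be a (multiplicative) Hom-Malcev algebra over $\mathbb K$. Define on $\mathfrak m$ a ternary operation by $$\{x,y,z\}:=-J_{\alpha}(x,y,z)+2[[x,y],\alpha(z)]\qquad (x,y,z\in\mathfrak m),$$ where $J_{\alpha}(x,y,z):=[[x,y],\alpha(z)]+[[y,z],\alpha(x)]+[[z,x],\alpha(y)]$. Then $$\{\alpha(x),\alpha(y),[u,v]\}=[\{x,y,u\},\alpha^{2}(v)]+[\alpha^{2}(u),\{x,y,v\}]$$ for all $u,v,x,y\in\mathfrak m$.
   Context: A (multiplicative) Hom-Malcev algebra is a triple $(A,[\,,],\alpha)$ consisting of a $\mathbb K$-vector space $A$, a bilinear operation $[\,,]$ on $A$ and a linear map $\alpha:A\to A$ with $\alpha([x,y])=[\alpha(x),\alpha(y)]$, such that $[\,,]$ is skew-symmetric and the Hom-Malcev identity $$J_{\alpha}(\alpha(x),\alpha(y),[x,z])=[J_{\alpha}(x,y,z),\alpha^{2}(x)]$$ holds for all $x,y,z\in A$, where $J_{\alpha}(x,y,z)=[[x,y],\alpha(z)]+[[y,z],\alpha(x)]+[[z,x],\alpha(y)]$. *)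

theory Defs
  imports Complex_Main
begin

definition hom_jacobian :: "('a::ab_group_add \<Rightarrow> 'a \<Rightarrow> 'a) \<Rightarrow> ('a \<Rightarrow> 'a) \<Rightarrow> 'a \<Rightarrow> 'a \<Rightarrow> 'a \<Rightarrow> 'a"
  where "hom_jacobian br \<alpha> x y z =
    br (br x y) (\<alpha> z) + br (br y z) (\<alpha> x) + br (br z x) (\<alpha> y)"

text \<open>The vector space is the whole type \<open>'a\<close> with scalar multiplication \<open>scale\<close>.
  Skew-symmetry is \<open>[x,y] = -[y,x]\<close>.\<close>

locale hom_malcev_algebra = vector_space scale
  for scale :: "'k::field \<Rightarrow> 'a::ab_group_add \<Rightarrow> 'a" +
  fixes br :: "'a \<Rightarrow> 'a \<Rightarrow> 'a" and \<alpha> :: "'a \<Rightarrow> 'a"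
  assumes br_linear_right: "\<And>x. Vector_Spaces.linear scale scale (\<lambda>y. br x y)"
    and br_linear_left: "\<And>y. Vector_Spaces.linear scale scale (\<lambda>x. br x y)"
    and alpha_linear: "Vector_Spaces.linear scale scale \<alpha>"
    and alpha_mult: "\<And>x y. \<alpha> (br x y) = br (\<alpha> x) (\<alpha> y)"
    and br_skew: "\<And>x y. br x y = - br y x"
    and hom_malcev: "\<And>x y z. hom_jacobian br \<alpha> (\<alpha> x) (\<alpha> y) (br x z)
                             = br (hom_jacobian br \<alpha> x y z) (\<alpha> (\<alpha> x))"

definition hom_triple ::
    "('k::field \<Rightarrow> 'a::ab_group_add \<Rightarrow> 'a) \<Rightarrow> ('a \<Rightarrow> 'a \<Rightarrow> 'a) \<Rightarrow> ('a \<Rightarrow> 'a) \<Rightarrow> 'a \<Rightarrow> 'a \<Rightarrow> 'a \<Rightarrow> 'a"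
  where "hom_triple scale br \<alpha> x y z =
    - hom_jacobian br \<alpha> x y z + scale 2 (br (br x y) (\<alpha> z))"

end

theory Submission
  imports Defs
begin

text \<open>
  Write \<open>J\<close> for the Hom-Jacobian, which is alternating, and put
  \<open>F(x,y;u,v) = J(\<alpha> x, \<alpha> y, [u,v])\<close> and \<open>G(x,y,z;w) = [J(x,y,z), \<alpha>\<^sup>2 w]\<close>.
  Expanding the ternary operation by bilinearity and cancelling the terms of the form
  \<open>[[\<alpha> x, \<alpha> y], [\<alpha> u, \<alpha> v]]\<close>, the proposition says exactly

  \<open>F(x,y;u,v) + 2 F(u,v;x,y) = G(x,y,u;v) - G(x,y,v;u)\<close>,

  a relation in which only \<open>J\<close> occurs. This relation is linear in \<open>F\<close> and \<open>G\<close>, and it follows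
  from two sources. The first is the Hom-Malcev identity polarized in its repeated variable
  (\<open>polarized_hom_malcev\<close>). It expresses all six values of \<open>F\<close> on four given elements, up to sign,
  through a single one of them and values of \<open>G\<close>, but leaves that last one undetermined.
  The second source is a relation valid for every multiplicative skew-symmetric bracket
  (\<open>jacobian_syzygy\<close>): the six values of \<open>F\<close> and the four values of \<open>G\<close> on four elements satisfy
  one linear relation. Together they give a Hom-version of Sagle's identity for Malcev algebras,

  \<open>F(x,w;y,z) + F(y,w;z,x) + F(z,w;x,y) = 2 G(x,y,z;w)\<close>

  (\<open>sagle_identity\<close>). It comes out multiplied by 2, and this is where the characteristic enters.
  Two further polarizations turn it into the relation above.
\<close>

context hom_malcev_algebra
begin

abbreviation J :: "'a \<Rightarrow> 'a \<Rightarrow> 'a \<Rightarrow> 'a"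
  where "J \<equiv> hom_jacobian br \<alpha>"

abbreviation F :: "'a \<Rightarrow> 'a \<Rightarrow> 'a \<Rightarrow> 'a \<Rightarrow> 'a"
  where "F x y u v \<equiv> J (\<alpha> x) (\<alpha> y) (br u v)"

abbreviation G :: "'a \<Rightarrow> 'a \<Rightarrow> 'a \<Rightarrow> 'a \<Rightarrow> 'a"
  where "G x y z w \<equiv> br (J x y z) (\<alpha> (\<alpha> w))"

lemma br_add_right: "br x (y + z) = br x y + br x z"
  and br_minus_right: "br x (- y) = - br x y"
  and br_diff_right: "br x (y - z) = br x y - br x z"
  using br_linear_right[of x]
  by (simp_all add: linear_iff_module_hom module_hom.add module_hom.neg module_hom.diff)

lemma br_add_left: "br (y + z) x = br y x + br z x"
  and br_minus_left: "br (- y) x = - br y x"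
  and br_diff_left: "br (y - z) x = br y x - br z x"
proof -
  have hom: "module_hom scale scale (\<lambda>y. br y x)"
    using br_linear_left[of x] by (simp add: linear_iff_module_hom)
  show "br (y + z) x = br y x + br z x" "br (- y) x = - br y x" "br (y - z) x = br y x - br z x"
    using module_hom.add[OF hom] module_hom.neg[OF hom] module_hom.diff[OF hom] by simp_all
qed

lemma alpha_add: "\<alpha> (y + z) = \<alpha> y + \<alpha> z"
  and alpha_minus: "\<alpha> (- y) = - \<alpha> y"
  using alpha_linear
  by (simp_all add: linear_iff_module_hom module_hom.add module_hom.neg)

lemmas br_additive = br_add_right br_add_left br_minus_right br_minus_left
  br_diff_right br_diff_left

lemma jacobian_cyclic: "J y z x = J x y z"
  by (simp add: hom_jacobian_def add_ac)

lemma jacobian_swap: "J y x z = - J x y z"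
  using br_skew[of y x] br_skew[of x z] br_skew[of z y]
  by (simp add: hom_jacobian_def br_additive)

lemma F_skew_left: "F y x u v = - F x y u v"
  by (rule jacobian_swap)

lemma F_skew_right: "F x y v u = - F x y u v"
  by (simp add: hom_jacobian_def br_skew[of v u] br_additive alpha_minus)

lemma G_cyclic: "G y z x w = G x y z w"
  by (simp add: jacobian_cyclic)

lemma G_swap: "G y x z w = - G x y z w"
  by (simp add: jacobian_swap[of y x] br_minus_left)

lemma jacobian_add: "J (x + w) y z = J x y z + J w y z" "J x y (z + w) = J x y z + J x y w"
  by (simp_all add: hom_jacobian_def br_additive alpha_add add_ac)

lemma polarized_hom_malcev: "F x y w z + F w y x z = G x y z w + G w y z x"
  using hom_malcev[of "x + w" y z] hom_malcev[of x y z] hom_malcev[of w y z]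
  by (simp add: jacobian_add br_additive alpha_add algebra_simps)

text \<open>
  Modulo values of \<open>G\<close>, polarization makes \<open>F\<close> change sign when an element of one pair is
  interchanged with an element of the other. Interchanging \<open>x\<close> with \<open>u\<close> and then \<open>y\<close> with \<open>v\<close>
  swaps the pairs, and the two signs cancel.
\<close>

lemma F_exchange: "F x y u v - F u v x y = (G x y v u - G x y u v) - (G u v y x - G u v x y)"
proof -
  have "F x v u y + F u v x y = G x v y u + G u v y x"
    by (rule polarized_hom_malcev)
  moreover have "G x v y u = - G x y v u"
    by (metis G_cyclic G_swap)
  ultimately have first: "F x v u y = G u v y x - G x y v u - F u v x y"
    by (simp add: algebra_simps)
  have "F y x v u + F v x y u = G y x u v + G v x u y"
    by (rule polarized_hom_malcev)
  moreover have "F y x v u = F x y u v" "F v x y u = F x v u y"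
    by (metis F_skew_left F_skew_right minus_minus)+
  moreover have "G y x u v = - G x y u v" "G v x u y = G u v x y"
    by (metis G_cyclic G_swap)+
  ultimately have "F x y u v = G u v x y - G x y u v - F x v u y"
    by (simp add: algebra_simps)
  then show ?thesis by (simp add: first algebra_simps)
qed

lemma F_expand:
  "F x y u v = br (br (\<alpha> x) (\<alpha> y)) (br (\<alpha> u) (\<alpha> v))
     + br (br (br u v) (\<alpha> x)) (\<alpha> (\<alpha> y)) - br (br (br u v) (\<alpha> y)) (\<alpha> (\<alpha> x))"
  by (simp add: hom_jacobian_def alpha_mult br_additive br_skew[of "\<alpha> y" "br u v"])

text \<open>
  On the left the squares \<open>[[\<alpha> a, \<alpha> b], [\<alpha> c, \<alpha> d]]\<close> cancel, because the two ways of ordering the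
  pairs \<open>a,b\<close> and \<open>c,d\<close> both occur with the same sign and the bracket is skew. The remaining terms
  \<open>[[[a,b], \<alpha> c], \<alpha>\<^sup>2 d]\<close>, collected by \<open>d\<close>, add up for each \<open>d\<close> to plus or minus the
  Jacobian of the other three elements, bracketed with \<open>\<alpha>\<^sup>2 d\<close>.
\<close>

lemma jacobian_syzygy:
  "(F x w y z + F y w z x + F z w x y) + (F y z x w + F z x y w + F x y z w)
     = G x y z w - G w y z x - G x w z y - G x y w z"
proof -
  have base: "br y x = - br x y" "br z x = - br x z" "br w x = - br x w"
    "br z y = - br y z" "br w y = - br y w" "br w z = - br z w"
    by (rule br_skew)+
  have alpha_base:
    "br (\<alpha> y) (\<alpha> x) = - br (\<alpha> x) (\<alpha> y)" "br (\<alpha> z) (\<alpha> x) = - br (\<alpha> x) (\<alpha> z)"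
    "br (\<alpha> w) (\<alpha> x) = - br (\<alpha> x) (\<alpha> w)" "br (\<alpha> z) (\<alpha> y) = - br (\<alpha> y) (\<alpha> z)"
    "br (\<alpha> w) (\<alpha> y) = - br (\<alpha> y) (\<alpha> w)" "br (\<alpha> w) (\<alpha> z) = - br (\<alpha> z) (\<alpha> w)"
    by (rule br_skew)+
  have square:
    "br (br (\<alpha> z) (\<alpha> w)) (br (\<alpha> x) (\<alpha> y)) = - br (br (\<alpha> x) (\<alpha> y)) (br (\<alpha> z) (\<alpha> w))"
    "br (br (\<alpha> y) (\<alpha> w)) (br (\<alpha> x) (\<alpha> z)) = - br (br (\<alpha> x) (\<alpha> z)) (br (\<alpha> y) (\<alpha> w))"
    "br (br (\<alpha> y) (\<alpha> z)) (br (\<alpha> x) (\<alpha> w)) = - br (br (\<alpha> x) (\<alpha> w)) (br (\<alpha> y) (\<alpha> z))"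
    by (rule br_skew)+
  show ?thesis
    unfolding F_expand unfolding hom_jacobian_def
    by (simp add: base alpha_base square br_additive algebra_simps)
qed

lemma two_scale: "scale 2 p = p + p"
  using scale_left_distrib[of 1 1 p] by simp

lemma add_self_cancel:
  fixes p q :: 'a
  assumes "(2::'k) \<noteq> 0" and "p + p = q + q"
  shows "p = q"
proof -
  have "scale 2 p = scale 2 q"
    using assms(2) by (simp add: two_scale)
  then show ?thesis using assms(1) by simp
qed

text \<open>
  The syzygy has two groups of three summands. Exchanging the pairs of arguments turns the second
  group into the first one, at the cost of values of \<open>G\<close>, so that the syzygy becomes a formula for
  twice the first group.
\<close>

lemma sagle_identity:
  assumes "(2::'k) \<noteq> 0"
  shows "F x w y z + F y w z x + F z w x y = G x y z w + G x y z w"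
proof (rule add_self_cancel[OF assms])
  have "G x w y z = - G x y w z" "G y z w x = G w y z x" "G y z x w = G x y z w"
    "G y w x z = G x y w z" "G y w z x = - G w y z x" "G z x w y = G x w z y"
    "G z x y w = G x y z w" "G z w y x = G w y z x" "G z w x y = - G x w z y"
    by (metis G_cyclic G_swap)+
  note normal_form = this
  let ?S = "F x w y z + F y w z x + F z w x y"
  let ?T = "F y z x w + F z x y w + F x y z w"
  have "?S + ?S = (?S + ?T) +
      ((F x w y z - F y z x w) + (F y w z x - F z x y w) + (F z w x y - F x y z w))"
    by (simp add: algebra_simps)
  also have "\<dots> = (G x y z w + G x y z w) + (G x y z w + G x y z w)"
    unfolding jacobian_syzygy F_exchange normal_form by (simp add: algebra_simps)
  finally show "?S + ?S = (G x y z w + G x y z w) + (G x y z w + G x y z w)" .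
qed

text \<open>
  In other words, \<open>J(x,y,-)\<close> misses being a derivation (twisted by \<open>\<alpha>\<close>) by \<open>- 2 F(u,v;x,y)\<close>.
  By \<open>F_expand\<close> the map \<open>[[x,y], \<alpha>(-)]\<close> misses it by \<open>- F(u,v;x,y)\<close>, which is why
  the combination \<open>- J(x,y,-) + 2 [[x,y], \<alpha>(-)]\<close> is a derivation.
  In Sagle's identity for \<open>x, y, v, u\<close> the third summand is \<open>- F(u,v;x,y)\<close>, and one polarization
  of each of the other two brings in, modulo values of \<open>G\<close>, another \<open>- F(u,v;x,y)\<close> and \<open>- F(x,y;u,v)\<close>.
\<close>

lemma jacobian_derivation_defect:
  assumes "(2::'k) \<noteq> 0"
  shows "F x y u v + (F u v x y + F u v x y) = G x y u v - G x y v u"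
proof -
  have "F x u v y + F v u x y = G x u y v + G v u y x"
    by (rule polarized_hom_malcev)
  moreover have "F v u x y = - F u v x y"
    by (rule F_skew_left)
  moreover have "G x u y v = - G x y u v" "G v u y x = G u y v x"
    by (metis G_cyclic G_swap)+
  ultimately have first: "F x u v y = G u y v x - G x y u v + F u v x y"
    by (simp add: algebra_simps)
  have "F x u y v + F y u v x + F v u x y = G x y v u + G x y v u"
    by (rule sagle_identity[OF assms])
  moreover have "F x u y v = - F x u v y" "F v u x y = - F u v x y"
    by (rule F_skew_right F_skew_left)+
  moreover have "F y u v x = F u y x v"
    by (metis F_skew_left F_skew_right minus_minus)
  ultimately have second: "F u y x v = G x y v u + G x y v u + F x u v y + F u v x y"
    by (simp add: algebra_simps)
  have "F x y u v + F u y x v = G x y v u + G u y v x"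
    by (rule polarized_hom_malcev)
  then have "F x y u v = G x y v u + G u y v x - F u y x v"
    by (simp add: algebra_simps)
  then show ?thesis by (simp add: first second algebra_simps)
qed

lemma hom_triple_derivation:
  assumes "(2::'k) \<noteq> 0"
  shows "hom_triple scale br \<alpha> (\<alpha> x) (\<alpha> y) (br u v)
       = br (hom_triple scale br \<alpha> x y u) (\<alpha> (\<alpha> v))
         + br (\<alpha> (\<alpha> u)) (hom_triple scale br \<alpha> x y v)"
proof -
  have skew: "br (\<alpha> (\<alpha> u)) (hom_triple scale br \<alpha> x y v)
      = - br (hom_triple scale br \<alpha> x y v) (\<alpha> (\<alpha> u))"
    by (rule br_skew)
  have square: "br (br (\<alpha> u) (\<alpha> v)) (br (\<alpha> x) (\<alpha> y)) = - br (br (\<alpha> x) (\<alpha> y)) (br (\<alpha> u) (\<alpha> v))"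
    by (rule br_skew)
  have defect: "F x y u v = G x y u v - G x y v u - (F u v x y + F u v x y)"
    using jacobian_derivation_defect[OF assms, of x y u v] by (simp add: algebra_simps)
  show ?thesis
    unfolding skew unfolding hom_triple_def two_scale defect
    by (simp add: F_expand[of u v x y] square br_additive alpha_mult algebra_simps)
qed

end

theorem proposition4p2:
  fixes scale :: "'k::field_char_0 \<Rightarrow> 'm::ab_group_add \<Rightarrow> 'm"
    and br :: "'m \<Rightarrow> 'm \<Rightarrow> 'm"
    and \<alpha> :: "'m \<Rightarrow> 'm"
    and u v x y :: 'm
  assumes "hom_malcev_algebra scale br \<alpha>"
  shows "hom_triple scale br \<alpha> (\<alpha> x) (\<alpha> y) (br u v)
       = br (hom_triple scale br \<alpha> x y u) (\<alpha> (\<alpha> v))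
         + br (\<alpha> (\<alpha> u)) (hom_triple scale br \<alpha> x y v)"
  using assms by (rule hom_malcev_algebra.hom_triple_derivation) simp

end
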